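(* Let $G$ be a finite graph (loops and multiple edges allowed), let $d_m$ and $d_M$ be the minimum and the maximum vertex degree in $\mathrm{core}(G)$, respectively, and assume that $d_m\ge 2$. If $\beta\in\mathbb{C}$ satisfies $\omega_G(\beta)=0$, then $$\frac{1}{d_M-1}\le|\beta|\le\frac{1}{d_m-1}.$$
   Context: Graphs are finite undirected multigraphs; loops and multiple edges are allowed. The degree of a vertex is the number of edge-ends at it (a loop counts twice). For $s\subset E$, $d_i(s)$ is the degree of vertex $i$ in the spanning subgraph $(V,s)$. The core $\mathrm{core}(G)$ of $G$ is the graph obtained by repeatedly removing a vertex of degree one (together with its incident edge) until no vertex of degree one remains. The polynomials $f_n(x)$, $n\ge 0$, are defined by $f_0(x)=1$, $f_1(x)=0$, $f_{n+1}(x)=x f_n(x)+f_{n-1}(x)$ for $n\ge1$. Put $\theta_G(\beta,\gamma):=\sum_{s\subset E}\beta^{|s|}\prod_{i\in V}f_{d_i(s)}(\gamma)$ and $$\omega_G(\beta):=\frac{\theta_G(\beta,2\sqrt{-1})}{(1-\beta)^{|E|-|V|}},$$ which is a polynomial in $\mathbb{Z}[\beta]$. *)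

theory Defs
  imports Complex_Main "HOL-Library.Multiset" "HOL-Computational_Algebra.Polynomial"
begin

section \<open>Finite multigraphs\<close>

text \<open>Each edge carries the multiset of its two end vertices; the edge ends of a loop at \<open>v\<close>
  are \<open>{#v, v#}\<close>.\<close>

record ('v, 'e) multigraph =
  verts :: "'v set"
  edges :: "'e set"
  ends :: "'e \<Rightarrow> 'v multiset"

definition finite_multigraph :: "('v, 'e) multigraph \<Rightarrow> bool" where
  "finite_multigraph G \<longleftrightarrow> finite (verts G) \<and> finite (edges G) \<and>
     (\<forall>e\<in>edges G. size (ends G e) = 2 \<and> set_mset (ends G e) \<subseteq> verts G)"

definition degree_in :: "('v, 'e) multigraph \<Rightarrow> 'e set \<Rightarrow> 'v \<Rightarrow> nat" where
  "degree_in G s i = (\<Sum>e\<in>s. count (ends G e) i)"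

definition vdegree :: "('v, 'e) multigraph \<Rightarrow> 'v \<Rightarrow> nat" where
  "vdegree G i = degree_in G (edges G) i"


section \<open>The core\<close>

definition delete_vertex :: "('v, 'e) multigraph \<Rightarrow> 'v \<Rightarrow> ('v, 'e) multigraph" where
  "delete_vertex G v =
     G\<lparr>verts := verts G - {v}, edges := {e \<in> edges G. v \<notin># ends G e}\<rparr>"

definition prune_step :: "('v, 'e) multigraph \<Rightarrow> ('v, 'e) multigraph \<Rightarrow> bool" where
  "prune_step G H \<longleftrightarrow> (\<exists>v\<in>verts G. vdegree G v = 1 \<and> H = delete_vertex G v)"

text \<open>The core is a relation, because the result of the pruning is in general only determined up to
  isomorphism: pruning a single edge leaves either one of its two end vertices.\<close>

definition is_core :: "('v, 'e) multigraph \<Rightarrow> ('v, 'e) multigraph \<Rightarrow> bool" where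
  "is_core H G \<longleftrightarrow> prune_step\<^sup>*\<^sup>* G H \<and> (\<forall>v\<in>verts H. vdegree H v \<noteq> 1)"

lemma finite_multigraph_delete_vertex:
  assumes "finite_multigraph G"
  shows "finite_multigraph (delete_vertex G v)"
  using assms by (auto simp: finite_multigraph_def delete_vertex_def)

lemma ex_is_core:
  assumes "finite_multigraph G"
  shows "\<exists>H. is_core H G"
  using assms
proof (induction "card (verts G)" arbitrary: G rule: less_induct)
  case less
  show ?case
  proof (cases "\<exists>v\<in>verts G. vdegree G v = 1")
    case False
    then show ?thesis by (auto simp: is_core_def)
  next
    case True
    then obtain v where v: "v \<in> verts G" "vdegree G v = 1" by blast
    have "card (verts (delete_vertex G v)) < card (verts G)"
      using v(1) less.prems
      by (simp add: delete_vertex_def finite_multigraph_def card_Diff1_less del: card_Diff_insert)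
    from less.hyps[OF this finite_multigraph_delete_vertex[OF less.prems]]
    obtain H where "is_core H (delete_vertex G v)" by blast
    moreover have "prune_step G (delete_vertex G v)" using v by (auto simp: prune_step_def)
    ultimately show ?thesis by (auto simp: is_core_def intro: converse_rtranclp_into_rtranclp)
  qed
qed


section \<open>The polynomials \<open>f\<^sub>n\<close>, \<open>\<theta>\<close> and \<open>\<omega>\<close>\<close>

fun f_poly :: "nat \<Rightarrow> complex poly" where
  "f_poly 0 = 1"
| "f_poly (Suc 0) = 0"
| "f_poly (Suc (Suc n)) = [:0, 1:] * f_poly (Suc n) + f_poly n"

definition theta :: "('v, 'e) multigraph \<Rightarrow> complex \<Rightarrow> complex \<Rightarrow> complex" where
  "theta G \<beta> \<gamma> =
     (\<Sum>s\<in>Pow (edges G). \<beta> ^ card s * (\<Prod>i\<in>verts G. poly (f_poly (degree_in G s i)) \<gamma>))"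

text \<open>The quotient defining \<open>\<omega>\<close> is a polynomial with integer coefficients; the pointwise formula is
  used away from the possible pole at 1 only, and it determines the polynomial.\<close>

definition omega_poly :: "('v, 'e) multigraph \<Rightarrow> int poly" where
  "omega_poly G = (THE p. \<forall>\<beta>::complex. \<beta> \<noteq> 1 \<longrightarrow>
     poly (map_poly of_int p) \<beta> =
       theta G \<beta> (2 * \<i>) / (1 - \<beta>) powi (int (card (edges G)) - int (card (verts G))))"

definition omega :: "('v, 'e) multigraph \<Rightarrow> complex \<Rightarrow> complex" where
  "omega G \<beta> = poly (map_poly of_int (omega_poly G)) \<beta>"


text \<open>The rest shows that \<^const>\<open>omega_poly\<close> is well defined.\<close>

lemma poly_f_poly_2i: "poly (f_poly n) (2 * \<i>) = (1 - of_nat n) * \<i> ^ n"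
  by (induction n rule: f_poly.induct) (auto simp: algebra_simps)

lemma prod_f_poly_2i:
  assumes "finite_multigraph G" "s \<subseteq> edges G"
  shows "(\<Prod>i\<in>verts G. poly (f_poly (degree_in G s i)) (2 * \<i>)) =
    (-1) ^ card s * (\<Prod>i\<in>verts G. 1 - of_nat (degree_in G s i))"
proof -
  have fin: "finite (verts G)" using assms by (auto simp: finite_multigraph_def)
  have "(\<Sum>i\<in>verts G. degree_in G s i) = (\<Sum>e\<in>s. \<Sum>i\<in>verts G. count (ends G e) i)"
    unfolding degree_in_def by (rule sum.swap)
  also have "\<dots> = (\<Sum>e\<in>s. 2)"
  proof (rule sum.cong[OF refl])
    fix e assume "e \<in> s"
    then have "size (ends G e) = 2" "set_mset (ends G e) \<subseteq> verts G"
      using assms by (auto simp: finite_multigraph_def)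
    then show "(\<Sum>i\<in>verts G. count (ends G e) i) = 2"
      using sum.mono_neutral_left[OF fin, of "set_mset (ends G e)" "count (ends G e)"]
      by (auto simp: size_multiset_overloaded_eq not_in_iff)
  qed
  finally have "(\<Sum>i\<in>verts G. degree_in G s i) = 2 * card s" by simp
  then have "(\<Prod>i\<in>verts G. \<i> ^ degree_in G s i) = (-1) ^ card s"
    by (simp flip: power_sum add: power_mult)
  then show ?thesis by (simp add: poly_f_poly_2i prod.distrib)
qed

lemma subset_sum_dvd:
  fixes c :: "'e \<Rightarrow> 'v \<Rightarrow> int poly" and a :: "'v \<Rightarrow> int poly" and x :: "int poly"
  assumes "finite W" "finite E"
  shows "(1 + x) ^ (card E - card W) dvd
    (\<Sum>s\<in>Pow E. x ^ card s * (\<Prod>i\<in>W. a i - (\<Sum>e\<in>s. c e i)))"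
  using assms
proof (induction W arbitrary: E a rule: finite_induct)
  case empty
  have "(\<Sum>s\<in>Pow E. x ^ card s) = (1 + x) ^ card E"
    using prod_add[OF empty.prems, of "\<lambda>_. x" "\<lambda>_. 1"] by (simp add: add.commute)
  then show ?case by simp
next
  case (insert v W)
  let ?P = "\<lambda>a s. \<Prod>i\<in>W. a i - (\<Sum>e\<in>s. c e i)"
  let ?k = "card E - card (insert v W)"
  have "(\<Sum>s\<in>Pow E. x ^ card s * (\<Prod>i\<in>insert v W. a i - (\<Sum>e\<in>s. c e i))) =
      a v * (\<Sum>s\<in>Pow E. x ^ card s * ?P a s)
      - (\<Sum>s\<in>Pow E. \<Sum>e\<in>s. c e v * (x ^ card s * ?P a s))"
    using insert.hyps
    by (simp add: sum_distrib_left sum_distrib_right algebra_simps flip: sum_subtractf)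
  also have "(\<Sum>s\<in>Pow E. \<Sum>e\<in>s. c e v * (x ^ card s * ?P a s)) =
      (\<Sum>s\<in>Pow E. \<Sum>e\<in>E. if e \<in> s then c e v * (x ^ card s * ?P a s) else 0)"
    using insert.prems by (intro sum.cong[OF refl]) (auto simp: Int_absorb1 sum.If_cases)
  also have "\<dots> = (\<Sum>e\<in>E. \<Sum>s\<in>{s \<in> Pow E. e \<in> s}. c e v * (x ^ card s * ?P a s))"
    using insert.prems by (subst sum.swap) (simp add: sum.inter_filter del: Pow_iff)
  also have "\<dots> = (\<Sum>e\<in>E. c e v * x *
      (\<Sum>s\<in>Pow (E - {e}). x ^ card s * ?P (\<lambda>i. a i - c e i) s))"
  proof (rule sum.cong[OF refl])
    fix e assume e: "e \<in> E"
    have "(\<Sum>s\<in>{s \<in> Pow E. e \<in> s}. c e v * (x ^ card s * ?P a s)) =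
        (\<Sum>s\<in>Pow (E - {e}). c e v * (x ^ card (insert e s) * ?P a (insert e s)))"
      by (rule sum.reindex_bij_witness[of _ "insert e" "\<lambda>s. s - {e}"])
        (use e in \<open>auto simp: insert_absorb\<close>)
    also have "\<dots> = (\<Sum>s\<in>Pow (E - {e}).
        c e v * x * (x ^ card s * ?P (\<lambda>i. a i - c e i) s))"
    proof (rule sum.cong[OF refl])
      fix s assume s: "s \<in> Pow (E - {e})"
      then have "finite s" "e \<notin> s" using insert.prems by (auto intro: finite_subset)
      then show "c e v * (x ^ card (insert e s) * ?P a (insert e s)) =
          c e v * x * (x ^ card s * ?P (\<lambda>i. a i - c e i) s)"
        by (simp add: diff_diff_eq mult_ac)
    qed
    finally show "(\<Sum>s\<in>{s \<in> Pow E. e \<in> s}. c e v * (x ^ card s * ?P a s)) =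
        c e v * x * (\<Sum>s\<in>Pow (E - {e}). x ^ card s * ?P (\<lambda>i. a i - c e i) s)"
      by (simp add: sum_distrib_left)
  qed
  finally have eq: "(\<Sum>s\<in>Pow E. x ^ card s * (\<Prod>i\<in>insert v W. a i - (\<Sum>e\<in>s. c e i))) =
      a v * (\<Sum>s\<in>Pow E. x ^ card s * ?P a s) -
      (\<Sum>e\<in>E. c e v * x * (\<Sum>s\<in>Pow (E - {e}). x ^ card s * ?P (\<lambda>i. a i - c e i) s))" .
  have "(1 + x) ^ ?k dvd (\<Sum>s\<in>Pow E. x ^ card s * ?P a s)"
    by (rule dvd_trans[OF le_imp_power_dvd insert.IH[OF insert.prems]])
      (use insert.hyps in simp)
  moreover have "(1 + x) ^ ?k dvd
      (\<Sum>s\<in>Pow (E - {e}). x ^ card s * ?P (\<lambda>i. a i - c e i) s)" if "e \<in> E" for e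
    by (rule dvd_trans[OF le_imp_power_dvd insert.IH])
      (use insert.hyps insert.prems that in \<open>auto simp: card_Diff_singleton\<close>)
  ultimately show ?case
    unfolding eq by (rule dvd_diff[OF dvd_mult dvd_sum[OF dvd_mult]])
qed

lemma poly_map_poly_of_int_simps:
  fixes \<beta> :: complex
  shows "poly (map_poly of_int (p + q)) \<beta> = poly (map_poly of_int p) \<beta> + poly (map_poly of_int q) \<beta>"
    and "poly (map_poly of_int (p * q)) \<beta> = poly (map_poly of_int p) \<beta> * poly (map_poly of_int q) \<beta>"
    and "poly (map_poly of_int (1 :: int poly)) \<beta> = 1"
proof -
  have add: "poly (map_poly of_int (p + q)) \<beta> =
      poly (map_poly of_int p) \<beta> + poly (map_poly of_int q) \<beta>" for p q
    by (subst poly_add[symmetric], rule arg_cong[of _ _ "\<lambda>r. poly r \<beta>"])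
      (auto simp: poly_eq_iff coeff_map_poly)
  have smult: "poly (map_poly of_int (smult c q)) \<beta> = of_int c * poly (map_poly of_int q) \<beta>" for c q
    by (subst poly_smult[symmetric], rule arg_cong[of _ _ "\<lambda>r. poly r \<beta>"])
      (auto simp: poly_eq_iff coeff_map_poly)
  show "poly (map_poly of_int (p + q)) \<beta> =
      poly (map_poly of_int p) \<beta> + poly (map_poly of_int q) \<beta>" by (rule add)
  show "poly (map_poly of_int (p * q)) \<beta> =
      poly (map_poly of_int p) \<beta> * poly (map_poly of_int q) \<beta>"
    by (induction p) (simp_all add: add smult map_poly_pCons algebra_simps)
  show "poly (map_poly of_int (1 :: int poly)) \<beta> = 1" by simp
qed

lemma poly_map_poly_of_int_sum:
  fixes \<beta> :: complex
  shows "poly (map_poly of_int (\<Sum>i\<in>A. p i)) \<beta> = (\<Sum>i\<in>A. poly (map_poly of_int (p i)) \<beta>)"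
  by (induction A rule: infinite_finite_induct) (simp_all add: poly_map_poly_of_int_simps)

lemma poly_map_poly_of_int_prod:
  fixes \<beta> :: complex
  shows "poly (map_poly of_int (\<Prod>i\<in>A. p i)) \<beta> = (\<Prod>i\<in>A. poly (map_poly of_int (p i)) \<beta>)"
  by (induction A rule: infinite_finite_induct) (simp_all add: poly_map_poly_of_int_simps)

lemma poly_map_poly_of_int_power:
  fixes \<beta> :: complex
  shows "poly (map_poly of_int (p ^ n)) \<beta> = poly (map_poly of_int p) \<beta> ^ n"
  by (induction n) (simp_all add: poly_map_poly_of_int_simps)

lemma ex1_omega_poly:
  assumes "finite_multigraph G"
  shows "\<exists>!p::int poly. \<forall>\<beta>::complex. \<beta> \<noteq> 1 \<longrightarrow>
     poly (map_poly of_int p) \<beta> =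
       theta G \<beta> (2 * \<i>) / (1 - \<beta>) powi (int (card (edges G)) - int (card (verts G)))"
proof (rule ex_ex1I)
  have fin: "finite (verts G)" "finite (edges G)" using assms by (auto simp: finite_multigraph_def)
  let ?m = "card (edges G)" and ?n = "card (verts G)"
  define T :: "int poly" where "T = (\<Sum>s\<in>Pow (edges G). [:0, -1:] ^ card s *
      (\<Prod>i\<in>verts G. 1 - (\<Sum>e\<in>s. of_nat (count (ends G e) i))))"
  have T: "poly (map_poly of_int T) \<beta> = theta G \<beta> (2 * \<i>)" for \<beta> :: complex
  proof -
    have *: "poly (map_poly of_int (1 - (\<Sum>e\<in>s. of_nat (count (ends G e) i)))) \<beta> =
        1 - of_nat (degree_in G s i)" for s i
    proof -
      have "(1 - (\<Sum>e\<in>s. of_nat (count (ends G e) i)) :: int poly) =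
          [:1 - int (degree_in G s i):]"
        unfolding of_nat_sum[symmetric] degree_in_def[symmetric] by (simp add: of_nat_poly one_pCons)
      then show ?thesis by (simp add: map_poly_pCons)
    qed
    have "theta G \<beta> (2 * \<i>) = (\<Sum>s\<in>Pow (edges G). (- \<beta>) ^ card s *
        (\<Prod>i\<in>verts G. 1 - of_nat (degree_in G s i)))"
      unfolding theta_def
    proof (rule sum.cong[OF refl])
      fix s assume "s \<in> Pow (edges G)"
      then show "\<beta> ^ card s * (\<Prod>i\<in>verts G. poly (f_poly (degree_in G s i)) (2 * \<i>)) =
          (- \<beta>) ^ card s * (\<Prod>i\<in>verts G. 1 - of_nat (degree_in G s i))"
        using prod_f_poly_2i[OF assms, of s] by (simp only: Pow_iff) (simp add: power_minus[of \<beta>])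
    qed
    then show ?thesis
      by (simp add: T_def poly_map_poly_of_int_sum poly_map_poly_of_int_prod
        poly_map_poly_of_int_simps(2) poly_map_poly_of_int_power * map_poly_pCons)
  qed
  have lin: "poly (map_poly of_int [:1, -1 :: int:]) \<beta> = 1 - \<beta>" for \<beta> :: complex
    by (simp add: map_poly_pCons)
  have "(1 + [:0, -1:]) ^ (?m - ?n) dvd T"
    unfolding T_def using subset_sum_dvd[OF fin, of "[:0, -1:]" "\<lambda>_. 1"] by simp
  then obtain q where q: "T = [:1, -1:] ^ (?m - ?n) * q"
    by (auto simp: one_pCons elim: dvdE)
  show "\<exists>p::int poly. \<forall>\<beta>::complex. \<beta> \<noteq> 1 \<longrightarrow>
     poly (map_poly of_int p) \<beta> = theta G \<beta> (2 * \<i>) / (1 - \<beta>) powi (int ?m - int ?n)"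
  proof (intro exI allI impI)
    fix \<beta> :: complex assume "\<beta> \<noteq> 1"
    then show "poly (map_poly of_int ([:1, -1:] ^ (?n - ?m) * q)) \<beta> =
        theta G \<beta> (2 * \<i>) / (1 - \<beta>) powi (int ?m - int ?n)"
      unfolding T[symmetric] q
      by (cases "?n \<le> ?m")
        (simp_all add: poly_map_poly_of_int_simps(2) poly_map_poly_of_int_power lin
          power_int_def nat_diff_distrib field_simps)
  qed
next
  fix p q :: "int poly"
  let ?R = "\<lambda>\<beta>. theta G \<beta> (2 * \<i>) / (1 - \<beta>) powi (int (card (edges G)) - int (card (verts G)))"
  assume "\<forall>\<beta>::complex. \<beta> \<noteq> 1 \<longrightarrow> poly (map_poly of_int p) \<beta> = ?R \<beta>"
    and "\<forall>\<beta>::complex. \<beta> \<noteq> 1 \<longrightarrow> poly (map_poly of_int q) \<beta> = ?R \<beta>"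
  then have "UNIV - {1} \<subseteq>
      {\<beta>::complex. poly (map_poly of_int p - map_poly of_int q) \<beta> = 0}"
    by auto
  moreover have "infinite (UNIV - {1::complex})"
    by (simp add: infinite_UNIV_char_0)
  ultimately have "map_poly of_int p - map_poly of_int q = (0 :: complex poly)"
    using poly_roots_finite finite_subset by metis
  then show "p = q" by (simp add: poly_eq_iff coeff_map_poly)
qed

lemma omega_eq:
  assumes "finite_multigraph G" "\<beta> \<noteq> 1"
  shows "omega G \<beta> =
    theta G \<beta> (2 * \<i>) / (1 - \<beta>) powi (int (card (edges G)) - int (card (verts G)))"
  using theI'[OF ex1_omega_poly[OF assms(1)]] assms(2)
  unfolding omega_def omega_poly_def by blast

end

theory Submission
  imports Defs
begin

text \<open>
  At \<open>\<gamma> = 2\<i>\<close> the polynomial \<open>f\<^sub>n\<close> takes the value \<open>(1 - n) \<i>\<^sup>n\<close>, so that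
  \<open>\<theta>\<close> becomes \<open>\<Sum>\<^sub>s (-\<beta>)\<^bsup>|s|\<^esup> \<Prod>\<^sub>i (1 - d\<^sub>i(s))\<close>. Each factor is affine in the indicators of the
  edges at its vertex, and for \<open>\<beta> \<noteq> 1\<close> these indicators are, up to normalisation, independent
  (formal) Bernoulli variables of parameter \<open>p = -\<beta> / (1 - \<beta>)\<close>. If the factors of different vertices
  were independent, the result would be \<open>\<Prod>\<^sub>i (1 - p d\<^sub>i)\<close>. The only defect comes from the edges that
  expanding the product selects from both ends, and such edges form a matching.
  Hence \<open>\<omega>\<close> is a weighted matching polynomial (\<open>omega_eq_matching_sum\<close>):
  \<open>\<omega>(\<beta>) = \<Sum>\<^sub>D (-\<beta>)\<^bsup>|D|\<^esup> \<Prod> (1 + (d\<^sub>i - 1) \<beta>)\<close>, where \<open>D\<close> runs over the matchings and \<open>i\<close> over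
  the vertices that \<open>D\<close> leaves uncovered. In the proof both sides are generalised to sums over a
  vertex set \<open>W\<close>, and shown to obey the same recursion when a vertex is added to \<open>W\<close>.

  The zeros are then located in the way of Heilmann and Lieb, by following the ratio of the matching
  sums of \<open>W\<close> and \<open>W - {v}\<close> along that recursion. Let \<open>u\<^sup>2 = \<beta>\<close>. The imaginary part of
  \<open>(1 + (d\<^sub>i - 1) \<beta>) / u\<close> is \<open>Im u (d\<^sub>i - 1 - 1 / |\<beta>|)\<close>, so for \<open>\<beta>\<close> outside the annulus all these vertex
  weights lie in the same open half plane as soon as \<open>u\<close> is not real, and the half plane is
  preserved by the recursion (\<open>matching_sum_nonzero_half_plane\<close>). Since \<open>\<omega>(0) = 1\<close>, this leaves the case
  \<open>\<beta> > 0\<close>, which needs another argument: if all degrees are at least 2, then the ratios are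
  positive, because a vertex that has already lost a neighbour has residual degree at most
  \<open>d\<^sub>i - 1\<close> (\<open>matching_sum_pos\<close>).

  Since \<open>f\<^sub>1 = 0\<close>, a subgraph with a vertex of degree one contributes nothing to \<open>\<theta>\<close>. Pruning
  therefore leaves \<open>\<omega>\<close> unchanged (\<open>omega_prune\<close>), and it suffices to look at the core.
\<close>

section \<open>Degrees and multiplicities\<close>

definition edge_mult :: "('v, 'e) multigraph \<Rightarrow> 'v \<Rightarrow> 'v \<Rightarrow> nat" where
  "edge_mult G v w = card {e \<in> edges G. ends G e = {#v, w#}}"

lemma edge_mult_commute: "edge_mult G v w = edge_mult G w v"
  by (simp add: edge_mult_def add_mset_commute)

lemma degree_in_insert:
  assumes "finite s" "e \<notin> s"
  shows "degree_in G (insert e s) i = count (ends G e) i + degree_in G s i"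
  using assms by (simp add: degree_in_def)

lemma ends_eq_pair:
  assumes "finite_multigraph G" "e \<in> edges G" "v \<in># ends G e"
  obtains w where "ends G e = {#v, w#}"
proof -
  obtain M where M: "ends G e = add_mset v M" using assms(3) by (auto dest: multi_member_split)
  moreover have "size (ends G e) = 2" using assms by (auto simp: finite_multigraph_def)
  ultimately have "size M = 1" by simp
  then obtain w where "M = {#w#}" using size_1_singleton_mset by blast
  then show thesis using M by (intro that[of w]) simp
qed

text \<open>The left-hand side is the number of edges from \<open>v\<close> into \<open>W\<close>. Loops at \<open>v\<close>
  and edges to vertices outside \<open>W\<close> add to the degree only, whence an inequality.\<close>

lemma sum_edge_mult_le_vdegree:
  assumes "finite_multigraph G" "finite W" "v \<notin> W"
  shows "(\<Sum>w\<in>W. edge_mult G v w) \<le> vdegree G v"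
proof -
  have fin: "finite (edges G)" using assms by (simp add: finite_multigraph_def)
  have "(\<Sum>w\<in>W. edge_mult G v w) = card (\<Union>w\<in>W. {e \<in> edges G. ends G e = {#v, w#}})"
    unfolding edge_mult_def
    by (rule card_UN_disjoint[symmetric]) (use fin assms(2) in auto)
  also have "\<dots> \<le> card {e \<in> edges G. v \<in># ends G e}"
    using fin by (intro card_mono) auto
  also have "\<dots> = (\<Sum>e\<in>{e \<in> edges G. v \<in># ends G e}. 1)" by simp
  also have "\<dots> \<le> (\<Sum>e\<in>{e \<in> edges G. v \<in># ends G e}. count (ends G e) v)"
    by (intro sum_mono) (simp add: Suc_le_eq)
  also have "\<dots> \<le> vdegree G v"
    unfolding vdegree_def degree_in_def using fin by (intro sum_mono2) auto
  finally show ?thesis .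
qed

section \<open>The weighted matching polynomial\<close>

text \<open>Matchings inside \<open>W\<close>, described by degrees: the bound 1 on \<open>W\<close> forces the edges to be
  disjoint and excludes loops, and the bound 0 elsewhere keeps their ends in \<open>W\<close>.\<close>

definition matchings :: "('v, 'e) multigraph \<Rightarrow> 'v set \<Rightarrow> 'e set set" where
  "matchings G W = {D. D \<subseteq> edges G \<and> (\<forall>i. degree_in G D i \<le> of_bool (i \<in> W))}"

definition matching_sum ::
  "('v, 'e) multigraph \<Rightarrow> ('v \<Rightarrow> 'a::comm_ring_1) \<Rightarrow> 'a \<Rightarrow> 'v set \<Rightarrow> 'a" where
  "matching_sum G a t W =
     (\<Sum>D\<in>matchings G W. t ^ card D * (\<Prod>i | i \<in> W \<and> degree_in G D i = 0. a i))"

lemma degree_in_matching_eq_0: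
  assumes "D \<in> matchings G W" "i \<notin> W"
  shows "degree_in G D i = 0"
proof -
  have "degree_in G D i \<le> of_bool (i \<in> W)" using assms(1) unfolding matchings_def by blast
  then show ?thesis using assms(2) by simp
qed

lemma matching_sum_empty:
  assumes "finite_multigraph G"
  shows "matching_sum G a t {} = 1"
proof -
  have "D = {}" if D: "D \<in> matchings G {}" for D
  proof (rule ccontr)
    assume "D \<noteq> {}"
    then obtain e where e: "e \<in> D" "e \<in> edges G" using D unfolding matchings_def by blast
    then have "ends G e \<noteq> {#}" using assms by (auto simp: finite_multigraph_def)
    then obtain v where "v \<in># ends G e" by blast
    moreover have "finite D"
      using that assms by (auto simp: matchings_def finite_multigraph_def intro: finite_subset)
    ultimately have "degree_in G D v \<noteq> 0" using e by (auto simp: degree_in_def)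
    then show False using that by (auto simp: matchings_def)
  qed
  then have "matchings G {} = {{}}" 
    by (intro equalityI subsetI) (simp_all add: matchings_def degree_in_def)
  then show ?thesis by (simp add: matching_sum_def)
qed

text \<open>Either \<open>v\<close> is uncovered, or it is matched by an edge to some \<open>w\<close>, and what remains is a
  matching inside \<open>W - {w}\<close>.\<close>

lemma matching_sum_insert:
  assumes G: "finite_multigraph G" and W: "finite W" "v \<notin> W"
  shows "matching_sum G a t (insert v W) =
    a v * matching_sum G a t W + t * (\<Sum>w\<in>W. of_nat (edge_mult G v w) * matching_sum G a t (W - {w}))"
proof -
  let ?g = "\<lambda>W D. t ^ card D * (\<Prod>i | i \<in> W \<and> degree_in G D i = 0. a i)"
  let ?E = "\<lambda>w. {e \<in> edges G. ends G e = {#v, w#}}"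
  let ?S = "SIGMA w:W. SIGMA e:?E w. matchings G (W - {w})"
  have fE: "finite (edges G)" using G by (simp add: finite_multigraph_def)
  have fM: "finite (matchings G U)" for U
    by (rule finite_subset[of _ "Pow (edges G)"]) (use fE in \<open>auto simp: matchings_def\<close>)
  have fD: "finite D" if "D \<in> matchings G U" for D U
    using that fE by (auto simp: matchings_def intro: finite_subset)
  have deg: "degree_in G (insert e D) i = count {#v, w#} i + degree_in G D i"
    and new: "e \<notin> D"
    if "w \<in> W" "e \<in> ?E w" "D \<in> matchings G (W - {w})" for e w D i
  proof -
    show "e \<notin> D"
    proof
      assume "e \<in> D"
      then have "count (ends G e) w \<le> degree_in G D w"
        unfolding degree_in_def using fD[OF that(3)] by (intro member_le_sum) auto
      moreover have "degree_in G D w = 0" using that(3) by (rule degree_in_matching_eq_0) simp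
      ultimately show False using that by (simp split: if_splits)
    qed
    then show "degree_in G (insert e D) i = count {#v, w#} i + degree_in G D i"
      using that fD[OF that(3)] by (simp add: degree_in_insert)
  qed
  let ?M0 = "{D \<in> matchings G (insert v W). degree_in G D v = 0}"
  let ?M1 = "{D \<in> matchings G (insert v W). degree_in G D v \<noteq> 0}"
  have M0: "?M0 = matchings G W"
  proof (intro equalityI subsetI)
    fix D assume D: "D \<in> ?M0"
    then have "degree_in G D i \<le> of_bool (i \<in> W)" for i
      by (cases "i = v") (auto simp: matchings_def of_bool_def split: if_splits)
    then show "D \<in> matchings G W" using D by (auto simp: matchings_def)
  next
    fix D assume D: "D \<in> matchings G W"
    then have "degree_in G D v = 0" using W by (intro degree_in_matching_eq_0)
    moreover have "degree_in G D i \<le> of_bool (i \<in> insert v W)" for i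
    proof -
      have "degree_in G D i \<le> of_bool (i \<in> W)" using D unfolding matchings_def by blast
      then show ?thesis by (auto simp: of_bool_def split: if_splits)
    qed
    ultimately show "D \<in> ?M0" using D by (auto simp: matchings_def)
  qed
  have "(\<Sum>D\<in>?M0. ?g (insert v W) D) = (\<Sum>D\<in>matchings G W. a v * ?g W D)"
  proof (rule sum.cong[OF M0])
    fix D assume "D \<in> matchings G W"
    then have "degree_in G D v = 0" using W by (intro degree_in_matching_eq_0)
    then have "{i. i \<in> insert v W \<and> degree_in G D i = 0} = insert v {i. i \<in> W \<and> degree_in G D i = 0}"
      by auto
    then show "?g (insert v W) D = a v * ?g W D" using W by simp
  qed
  then have sum0: "(\<Sum>D\<in>?M0. ?g (insert v W) D) = a v * matching_sum G a t W"
    by (simp add: matching_sum_def sum_distrib_left)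
  have "bij_betw (\<lambda>(w, e, D). insert e D) ?S ?M1"
    unfolding bij_betw_def
  proof
    show "inj_on (\<lambda>(w, e, D). insert e D) ?S"
    proof (rule inj_onI)
      fix p p' assume p: "p \<in> ?S" "p' \<in> ?S"
        "(case p of (w, e, D) \<Rightarrow> insert e D) = (case p' of (w, e, D) \<Rightarrow> insert e D)"
      obtain w e D w' e' D' where pp: "p = (w, e, D)" "p' = (w', e', D')" by (metis prod_cases3)
      have A: "w \<in> W" "e \<in> edges G" "ends G e = {#v, w#}" "D \<in> matchings G (W - {w})"
        and B: "w' \<in> W" "e' \<in> edges G" "ends G e' = {#v, w'#}" "D' \<in> matchings G (W - {w'})"
        and eq: "insert e D = insert e' D'"
        using p by (simp_all add: pp)
      have e: "e \<in> ?E w" and e': "e' \<in> ?E w'" using A B by auto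
      have "e' \<notin> D"
      proof
        assume "e' \<in> D"
        then have "count (ends G e') v \<le> degree_in G D v"
          unfolding degree_in_def using fD[OF A(4)] by (intro member_le_sum) auto
        moreover have "degree_in G D v = 0" by (rule degree_in_matching_eq_0[OF A(4)]) (use W in simp)
        ultimately show False using B by simp
      qed
      then have "e' = e" using eq by blast
      moreover have "w = w'" using A(3) B(3) \<open>e' = e\<close> by simp
      moreover have "D = D'"
        using eq \<open>e' = e\<close> new[OF A(1) e A(4)] new[OF B(1) e' B(4)] by (simp add: insert_ident)
      ultimately show "p = p'" by (simp add: pp)
    qed
    show "(\<lambda>(w, e, D). insert e D) ` ?S = ?M1"
    proof (intro equalityI subsetI)
      fix D' assume "D' \<in> (\<lambda>(w, e, D). insert e D) ` ?S"
      then obtain w e D where A: "w \<in> W" "e \<in> ?E w" "D \<in> matchings G (W - {w})"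
        and D': "D' = insert e D" by auto
      have vw: "v \<noteq> w" using A(1) W by auto
      have "degree_in G D v = 0" by (rule degree_in_matching_eq_0[OF A(3)]) (use W in simp)
      then have "degree_in G D' v = 1" using vw by (simp add: D' deg[OF A])
      moreover have "degree_in G D' i \<le> of_bool (i \<in> insert v W)" for i
      proof (cases "i = v \<or> i = w")
        case True
        then have "degree_in G D i = 0"
          by (intro degree_in_matching_eq_0[OF A(3)]) (use W in auto)
        then show ?thesis using True A(1) vw by (auto simp: D' deg[OF A])
      next
        case False
        have "degree_in G D i \<le> of_bool (i \<in> W - {w})"
          using A(3) unfolding matchings_def by blast
        then show ?thesis using False by (auto simp: D' deg[OF A])
      qed
      moreover have "D' \<subseteq> edges G" using A(2,3) by (auto simp: D' matchings_def)
      ultimately show "D' \<in> ?M1" by (simp add: matchings_def)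
    next
      fix D' assume D': "D' \<in> ?M1"
      then have "(\<Sum>e\<in>D'. count (ends G e) v) \<noteq> 0" by (simp add: degree_in_def)
      then obtain e where "e \<in> D'" "count (ends G e) v \<noteq> 0" by (rule sum.not_neutral_contains_not_neutral)
      then have e: "e \<in> D'" "v \<in># ends G e" by auto
      have DM: "D' \<in> matchings G (insert v W)" using D' by blast
      have fin: "finite D'" by (rule fD[OF DM])
      have eE: "e \<in> edges G" using DM e(1) unfolding matchings_def by blast
      obtain w where w: "ends G e = {#v, w#}" using ends_eq_pair[OF G eE e(2)] .
      define D where "D = D' - {e}"
      have ins: "D' = insert e D" "e \<notin> D" "finite D" using e fin by (auto simp: D_def)
      have d: "degree_in G D' i = count {#v, w#} i + degree_in G D i" for i
        by (simp only: ins(1) degree_in_insert[OF ins(3,2)] w)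
      have le: "degree_in G D' i \<le> of_bool (i \<in> insert v W)" for i
        using DM unfolding matchings_def by blast
      have "w \<noteq> v" using d[of v] le[of v] by auto
      moreover have "w \<in> W" using d[of w] le[of w] \<open>w \<noteq> v\<close> by (cases "w \<in> W") auto
      moreover have "D \<in> matchings G (W - {w})"
      proof -
        have "degree_in G D i \<le> of_bool (i \<in> W - {w})" for i
          using d[of i] le[of i] \<open>w \<noteq> v\<close>
          by (cases "i = v \<or> i = w") (auto simp: of_bool_def split: if_splits)
        moreover have "D \<subseteq> edges G" using DM by (auto simp: D_def matchings_def)
        ultimately show ?thesis unfolding matchings_def by blast
      qed
      ultimately have "(w, e, D) \<in> ?S" using eE w by auto
      then show "D' \<in> (\<lambda>(w, e, D). insert e D) ` ?S" using ins(1) by force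
    qed
  qed
  then have "(\<Sum>D\<in>?M1. ?g (insert v W) D) = (\<Sum>(w, e, D)\<in>?S. ?g (insert v W) (insert e D))"
    by (subst sum.reindex_bij_betw[symmetric], assumption) (simp add: case_prod_unfold)
  also have "\<dots> = (\<Sum>(w, e, D)\<in>?S. t * ?g (W - {w}) D)"
  proof (rule sum.cong[OF refl], clarify)
    fix w e D assume A: "w \<in> W" "e \<in> edges G" "ends G e = {#v, w#}" "D \<in> matchings G (W - {w})"
    then have e: "e \<in> ?E w" by auto
    have "{i. i \<in> insert v W \<and> degree_in G (insert e D) i = 0} =
        {i. i \<in> W - {w} \<and> degree_in G D i = 0}"
    proof (intro Collect_cong)
      fix i
      show "i \<in> insert v W \<and> degree_in G (insert e D) i = 0 \<longleftrightarrow>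
          i \<in> W - {w} \<and> degree_in G D i = 0"
        using W by (cases "i = v \<or> i = w") (auto simp: deg[OF A(1) e A(4)])
    qed
    then show "?g (insert v W) (insert e D) = t * ?g (W - {w}) D"
      using new[OF A(1) e A(4)] fD[OF A(4)] by simp
  qed
  also have "\<dots> = (\<Sum>w\<in>W. \<Sum>e\<in>?E w. \<Sum>D\<in>matchings G (W - {w}). t * ?g (W - {w}) D)"
  proof -
    have "(\<Sum>e\<in>?E w. \<Sum>D\<in>matchings G (W - {w}). t * ?g (W - {w}) D) =
        (\<Sum>(e, D)\<in>?E w \<times> matchings G (W - {w}). t * ?g (W - {w}) D)" for w
      by (rule sum.cartesian_product)
    then have "(\<Sum>w\<in>W. \<Sum>e\<in>?E w. \<Sum>D\<in>matchings G (W - {w}). t * ?g (W - {w}) D) =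
        (\<Sum>w\<in>W. \<Sum>(e, D)\<in>?E w \<times> matchings G (W - {w}). t * ?g (W - {w}) D)"
      by (simp only:)
    also have "\<dots> = (\<Sum>(w, e, D)\<in>?S. t * ?g (W - {w}) D)"
      by (rule sum.Sigma) (use W fE fM in auto)
    finally show ?thesis by (rule sym)
  qed
  also have "\<dots> = t * (\<Sum>w\<in>W. of_nat (edge_mult G v w) * matching_sum G a t (W - {w}))"
    by (simp add: matching_sum_def edge_mult_def sum_distrib_left mult_ac)
  finally have sum1: "(\<Sum>D\<in>?M1. ?g (insert v W) D) =
    t * (\<Sum>w\<in>W. of_nat (edge_mult G v w) * matching_sum G a t (W - {w}))" .
  have "matching_sum G a t (insert v W) =
      (\<Sum>D\<in>?M0. ?g (insert v W) D) + (\<Sum>D\<in>?M1. ?g (insert v W) D)"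
    unfolding matching_sum_def
    by (subst sum.union_disjoint[symmetric]) (auto simp: fM intro!: sum.cong)
  then show ?thesis unfolding sum0 sum1 .
qed

lemma matching_sum_remove:
  assumes "finite_multigraph G" "finite W" "v \<in> W"
  shows "matching_sum G a t W = a v * matching_sum G a t (W - {v}) +
    t * (\<Sum>w\<in>W - {v}. of_nat (edge_mult G v w) * matching_sum G a t (W - {v} - {w}))"
  using matching_sum_insert[OF assms(1), of "W - {v}" v a t] assms by (simp add: insert_absorb)

lemma of_real_matching_sum:
  "of_real (matching_sum G a t W) =
    (matching_sum G (\<lambda>i. of_real (a i)) (of_real t) W :: 'b::{real_algebra_1, comm_ring_1})"
  by (simp add: matching_sum_def)

section \<open>Subgraph sums as matching sums\<close>

text \<open>This is \<open>\<theta>\<close> at \<open>\<beta> = -x\<close> and \<open>\<gamma> = 2\<i>\<close>, except that the vertex factors are restricted to \<open>W\<close> while all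
  edges are kept. This leaves the vertex set as the only thing that varies in the recursion.\<close>

definition subgraph_sum :: "('v, 'e) multigraph \<Rightarrow> complex \<Rightarrow> 'v set \<Rightarrow> complex" where
  "subgraph_sum G x W =
     (\<Sum>s\<in>Pow (edges G). x ^ card s * (\<Prod>i\<in>W. 1 - of_nat (degree_in G s i)))"

lemma sum_Pow_remove:
  fixes g :: "'e set \<Rightarrow> 'a::comm_monoid_add"
  assumes "finite E" "e \<in> E"
  shows "(\<Sum>s | s \<subseteq> E \<and> e \<in> s. g s) = (\<Sum>s\<in>Pow (E - {e}). g (insert e s))"
    and "(\<Sum>s\<in>Pow E. g s) = (\<Sum>s\<in>Pow (E - {e}). g s) + (\<Sum>s\<in>Pow (E - {e}). g (insert e s))"
proof -
  show *: "(\<Sum>s | s \<subseteq> E \<and> e \<in> s. g s) = (\<Sum>s\<in>Pow (E - {e}). g (insert e s))"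
    by (rule sum.reindex_bij_witness[of _ "insert e" "\<lambda>s. s - {e}"])
      (use assms in \<open>auto simp: insert_absorb\<close>)
  have "Pow E = Pow (E - {e}) \<union> {s. s \<subseteq> E \<and> e \<in> s}" using assms by auto
  then have "(\<Sum>s\<in>Pow E. g s) = (\<Sum>s\<in>Pow (E - {e}). g s) + (\<Sum>s | s \<subseteq> E \<and> e \<in> s. g s)"
    using assms by (simp only:) (rule sum.union_disjoint, auto)
  then show "(\<Sum>s\<in>Pow E. g s) = (\<Sum>s\<in>Pow (E - {e}). g s) + (\<Sum>s\<in>Pow (E - {e}). g (insert e s))"
    by (simp add: *)
qed

text \<open>The factor of \<open>v\<close> is \<open>1\<close> minus the number of ends at \<open>v\<close> of edges in \<open>s\<close>, so the sum splits
  into the sum for \<open>W\<close> minus, for each edge \<open>e\<close> at \<open>v\<close>, the part of that sum over the subgraphs that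
  contain \<open>e\<close>. If no end of \<open>e\<close> lies in \<open>W\<close>, this part is \<open>x / (1 + x)\<close> of the whole. If the other
  end \<open>w\<close> lies in \<open>W\<close>, adding \<open>e\<close> to \<open>s\<close> decreases the factor of \<open>w\<close> by one, which costs the sum
  for \<open>W - {w}\<close>; that is the correction term. Multiplying by \<open>(1 + x)\<^sup>2\<close> clears the denominators.\<close>

lemma subgraph_sum_insert:
  assumes G: "finite_multigraph G" and W: "finite W" "v \<notin> W"
  shows "(1 + x)\<^sup>2 * subgraph_sum G x (insert v W) =
    (1 + x) * (1 + x - x * of_nat (vdegree G v)) * subgraph_sum G x W
    + x * (\<Sum>w\<in>W. of_nat (edge_mult G v w) * subgraph_sum G x (W - {w}))"
proof -
  let ?T = "subgraph_sum G x"
  let ?F = "\<lambda>W s. \<Prod>i\<in>W. 1 - of_nat (degree_in G s i) :: complex"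
  let ?S = "\<lambda>e. \<Sum>s | s \<subseteq> edges G \<and> e \<in> s. x ^ card s * ?F W s"
  let ?c = "\<lambda>e. of_nat (count (ends G e) v) :: complex"
  have fE: "finite (edges G)" using G by (simp add: finite_multigraph_def)
  have S: "(1 + x)\<^sup>2 * (?c e * ?S e) = x * (1 + x) * ?T W * ?c e
      - x * (\<Sum>w\<in>W. of_bool (ends G e = {#v, w#}) * ?T (W - {w}))" if e: "e \<in> edges G" for e
  proof -
    \<comment> \<open>All sums in question are combinations of sums over the subgraphs that avoid \<open>e\<close>.\<close>
    let ?B = "\<lambda>U. \<Sum>s\<in>Pow (edges G - {e}). x ^ card s * ?F U s"
    have ins: "finite s" "e \<notin> s" "card (insert e s) = Suc (card s)"
      "degree_in G (insert e s) i = count (ends G e) i + degree_in G s i"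
      if "s \<in> Pow (edges G - {e})" for s i
    proof -
      show "finite s" "e \<notin> s" using that fE by (auto intro: finite_subset)
      then show "card (insert e s) = Suc (card s)"
        "degree_in G (insert e s) i = count (ends G e) i + degree_in G s i"
        by (simp_all add: degree_in_insert)
    qed
    have avoid: "(\<Sum>s\<in>Pow (edges G - {e}). x ^ card (insert e s) * ?F U (insert e s)) = x * ?B U"
      "?T U = (1 + x) * ?B U"
      if U: "\<And>i. i \<in> U \<Longrightarrow> i \<notin># ends G e" for U
    proof -
      have "?F U (insert e s) = ?F U s" if "s \<in> Pow (edges G - {e})" for s
        using U by (intro prod.cong refl) (simp add: ins(4)[OF that] not_in_iff)
      then show *: "(\<Sum>s\<in>Pow (edges G - {e}). x ^ card (insert e s) * ?F U (insert e s)) = x * ?B U"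
        unfolding sum_distrib_left by (intro sum.cong refl) (simp add: ins(3) mult_ac del: Pow_iff)
      show "?T U = (1 + x) * ?B U"
        unfolding subgraph_sum_def
        by (subst sum_Pow_remove(2)[OF fE e], subst *) (simp add: algebra_simps)
    qed
    consider "v \<notin># ends G e" | w where "ends G e = {#v, w#}" "w \<in> W" | w where "ends G e = {#v, w#}" "w \<notin> W"
      using ends_eq_pair[OF G e, of v] by blast
    then show ?thesis
    proof cases
      case 1
      then have "\<And>w. ends G e \<noteq> {#v, w#}" by auto
      then show ?thesis using 1 by (simp add: not_in_iff)
    next
      case (2 w)
      then have "w \<noteq> v" using W by auto
      have one: "?c e = 1" using 2 \<open>w \<noteq> v\<close> by simp
      have "(\<Sum>w'\<in>W. of_bool (ends G e = {#v, w'#}) * ?T (W - {w'})) =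
          (\<Sum>w'\<in>W. if w' = w then ?T (W - {w}) else 0)"
        by (intro sum.cong refl) (auto simp: 2)
      then have sumw: "(\<Sum>w'\<in>W. of_bool (ends G e = {#v, w'#}) * ?T (W - {w'})) = ?T (W - {w})"
        using 2 W by simp
      have F: "?F W (insert e s) = ?F W s - ?F (W - {w}) s" if s: "s \<in> Pow (edges G - {e})" for s
      proof -
        have "?F (W - {w}) (insert e s) = ?F (W - {w}) s"
          by (intro prod.cong refl) (use ins(4)[OF s] 2 W in auto)
        moreover have "degree_in G (insert e s) w = Suc (degree_in G s w)"
          using ins(4)[OF s, of w] 2 \<open>w \<noteq> v\<close> by simp
        ultimately show ?thesis
          using 2 W by (simp add: prod.remove[of W w] algebra_simps)
      qed
      then have Sx: "(\<Sum>s\<in>Pow (edges G - {e}). x ^ card (insert e s) * ?F W (insert e s)) =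
          x * (?B W - ?B (W - {w}))"
        unfolding sum_subtractf[symmetric] sum_distrib_left
        by (intro sum.cong refl) (simp add: ins(3) F algebra_simps del: Pow_iff)
      have T1: "?T W = ?B W + x * (?B W - ?B (W - {w}))"
        unfolding subgraph_sum_def by (subst sum_Pow_remove(2)[OF fE e], subst Sx) (rule refl)
      have T2: "?T (W - {w}) = (1 + x) * ?B (W - {w})"
        by (rule avoid(2)) (use 2 W in auto)
      have "?S e = x * (?B W - ?B (W - {w}))"
        by (subst sum_Pow_remove(1)[OF fE e]) (rule Sx)
      then show ?thesis
        unfolding sumw one T1 T2 by (simp only:) (simp add: algebra_simps power2_eq_square)
    next
      case (3 w)
      have av: "i \<notin># ends G e" if "i \<in> W" for i using that 3 W by auto
      have "(\<Sum>w'\<in>W. of_bool (ends G e = {#v, w'#}) * ?T (W - {w'})) = 0"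
        by (rule sum.neutral) (use 3 in auto)
      moreover have "?S e = x * ?B W"
        by (subst sum_Pow_remove(1)[OF fE e]) (rule avoid(1)[OF av])
      ultimately show ?thesis
        using avoid(2)[OF av] by (simp only:) (simp add: algebra_simps power2_eq_square)
    qed
  qed
  have "?T (insert v W) = (\<Sum>s\<in>Pow (edges G). x ^ card s * ?F W s
      - (\<Sum>e\<in>s. ?c e * (x ^ card s * ?F W s)))"
    unfolding subgraph_sum_def
    by (intro sum.cong refl)
      (use W in \<open>simp add: degree_in_def algebra_simps sum_distrib_left sum_distrib_right\<close>)
  also have "\<dots> = ?T W - (\<Sum>s\<in>Pow (edges G). \<Sum>e\<in>s. ?c e * (x ^ card s * ?F W s))"
    by (simp add: sum_subtractf subgraph_sum_def)
  also have "(\<Sum>s\<in>Pow (edges G). \<Sum>e\<in>s. ?c e * (x ^ card s * ?F W s)) =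
      (\<Sum>e\<in>edges G. \<Sum>s | s \<subseteq> edges G \<and> e \<in> s. ?c e * (x ^ card s * ?F W s))"
    using sum.swap_restrict[OF _ fE, of "Pow (edges G)"
        "\<lambda>s e. ?c e * (x ^ card s * ?F W s)" "\<lambda>s e. e \<in> s"] fE
    by (simp add: Collect_conj_eq Int_absorb1 Int_commute)
       (auto intro!: sum.cong simp: Int_absorb2)
  also have "\<dots> = (\<Sum>e\<in>edges G. ?c e * ?S e)" by (simp add: sum_distrib_left)
  finally have "(1 + x)\<^sup>2 * ?T (insert v W) =
      (1 + x)\<^sup>2 * ?T W - (\<Sum>e\<in>edges G. (1 + x)\<^sup>2 * (?c e * ?S e))"
    by (simp add: right_diff_distrib sum_distrib_left)
  also have "(\<Sum>e\<in>edges G. (1 + x)\<^sup>2 * (?c e * ?S e)) = x * (1 + x) * ?T W * of_nat (vdegree G v)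
      - x * (\<Sum>e\<in>edges G. \<Sum>w\<in>W. of_bool (ends G e = {#v, w#}) * ?T (W - {w}))"
    using S by (simp add: sum_subtractf vdegree_def degree_in_def flip: sum_distrib_left)
  also have "(\<Sum>e\<in>edges G. \<Sum>w\<in>W. of_bool (ends G e = {#v, w#}) * ?T (W - {w})) =
      (\<Sum>w\<in>W. of_nat (edge_mult G v w) * ?T (W - {w}))"
    by (subst sum.swap) (use fE in \<open>simp add: edge_mult_def Int_def flip: sum_distrib_right\<close>)
  finally show ?thesis by (simp add: algebra_simps power2_eq_square)
qed

text \<open>After multiplication by \<open>(1 + x)\<^bsup>|W|\<^esup>\<close>, the recursion of the subgraph sums is that of the
  matching sums, with vertex weights \<open>1 + x - x d\<^sub>i\<close> and edge weight \<open>x\<close>.\<close>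

lemma subgraph_sum_eq_matching_sum:
  assumes G: "finite_multigraph G" and x: "1 + x \<noteq> 0" and W: "finite W"
  shows "(1 + x) ^ card W * subgraph_sum G x W = (1 + x) ^ card (edges G) *
    matching_sum G (\<lambda>i. 1 + x - x * of_nat (vdegree G i)) x W"
  using W
proof (induction "card W" arbitrary: W rule: less_induct)
  case less
  let ?a = "\<lambda>i. 1 + x - x * of_nat (vdegree G i)"
  let ?T = "subgraph_sum G x" and ?M = "matching_sum G ?a x" and ?q = "(1 + x) ^ card (edges G)"
  have fE: "finite (edges G)" using G by (simp add: finite_multigraph_def)
  show ?case
  proof (cases "W = {}")
    case True
    have "?T {} = ?q"
      using prod_add[OF fE, of "\<lambda>_. x" "\<lambda>_. 1"] by (simp add: subgraph_sum_def add.commute)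
    then show ?thesis using True by (simp add: matching_sum_empty[OF G])
  next
    case False
    then obtain v where v: "v \<in> W" by blast
    define U where "U = W - {v}"
    have U: "W = insert v U" "v \<notin> U" "finite U" "card W = Suc (card U)"
      using v less.prems card_Suc_Diff1[OF less.prems v] by (auto simp: U_def)
    have IH1: "(1 + x) ^ card U * ?T U = ?q * ?M U"
      by (rule less.hyps) (use U in auto)
    have IH2: "(1 + x) ^ card U * ?T (U - {w}) = (1 + x) * (?q * ?M (U - {w}))" if "w \<in> U" for w
    proof -
      have "(1 + x) ^ card (U - {w}) * ?T (U - {w}) = ?q * ?M (U - {w})"
        by (rule less.hyps) (use U that in \<open>auto simp: less_Suc_eq_le card_Diff1_le\<close>)
      moreover have "card U = Suc (card (U - {w}))" by (rule card_Suc_Diff1[OF U(3) that, symmetric])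
      ultimately show ?thesis by (simp add: mult.assoc)
    qed
    \<comment> \<open>The extra factor \<open>1 + x\<close> is needed because \<open>card W\<close> may be 1, whereas the recursion carries
      the factor \<open>(1 + x)\<^sup>2\<close>.\<close>
    have "(1 + x) * ((1 + x) ^ card W * ?T W) = (1 + x) ^ card U * ((1 + x)\<^sup>2 * ?T (insert v U))"
      using U by (simp add: power2_eq_square mult_ac)
    also have "\<dots> = (1 + x) * ?a v * ((1 + x) ^ card U * ?T U)
        + x * (\<Sum>w\<in>U. of_nat (edge_mult G v w) * ((1 + x) ^ card U * ?T (U - {w})))"
      unfolding subgraph_sum_insert[OF G U(3,2)]
      by (simp add: distrib_left sum_distrib_left mult_ac)
    also have "\<dots> = (1 + x) * ?a v * (?q * ?M U)
        + x * (\<Sum>w\<in>U. of_nat (edge_mult G v w) * ((1 + x) * (?q * ?M (U - {w}))))"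
      by (simp add: IH1 IH2)
    also have "\<dots> = (1 + x) * (?q * ?M (insert v U))"
      unfolding matching_sum_insert[OF G U(3,2)]
      by (simp add: distrib_left sum_distrib_left mult_ac)
    finally show ?thesis using x U(1) by simp
  qed
qed

lemma theta_eq_subgraph_sum:
  assumes "finite_multigraph G"
  shows "theta G \<beta> (2 * \<i>) = subgraph_sum G (- \<beta>) (verts G)"
  unfolding theta_def subgraph_sum_def
proof (rule sum.cong[OF refl])
  fix s assume "s \<in> Pow (edges G)"
  then show "\<beta> ^ card s * (\<Prod>i\<in>verts G. poly (f_poly (degree_in G s i)) (2 * \<i>)) =
      (- \<beta>) ^ card s * (\<Prod>i\<in>verts G. 1 - of_nat (degree_in G s i))"
    using prod_f_poly_2i[OF assms, of s] by (simp only: Pow_iff) (simp add: power_minus[of \<beta>])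
qed

text \<open>For \<open>\<beta> \<noteq> 1\<close> this is the comparison of the recursions; at the point 1, where the quotient
  that defines \<open>\<omega>\<close> may be indeterminate, it follows by continuity.\<close>

theorem omega_eq_matching_sum:
  assumes G: "finite_multigraph G"
  shows "omega G \<beta> =
    matching_sum G (\<lambda>i. 1 + (of_nat (vdegree G i) - 1) * \<beta>) (- \<beta>) (verts G)"
proof -
  let ?M = "\<lambda>z::complex. matching_sum G (\<lambda>i. 1 + (of_nat (vdegree G i) - 1) * z) (- z) (verts G)"
  have fV: "finite (verts G)" using G by (simp add: finite_multigraph_def)
  have away: "omega G z = ?M z" if "z \<noteq> 1" for z
  proof -
    have "(\<lambda>i. 1 + - z - - z * of_nat (vdegree G i)) = (\<lambda>i. 1 + (of_nat (vdegree G i) - 1) * z)"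
      by (simp add: fun_eq_iff algebra_simps)
    moreover have "1 + - z \<noteq> 0" using that by simp
    ultimately have "(1 + - z) ^ card (verts G) * theta G z (2 * \<i>) = (1 + - z) ^ card (edges G) * ?M z"
      using subgraph_sum_eq_matching_sum[OF G _ fV, of "- z"]
      by (simp only: theta_eq_subgraph_sum[OF G] not_False_eq_True)
    then have num: "(1 - z) ^ card (verts G) * theta G z (2 * \<i>) = (1 - z) ^ card (edges G) * ?M z"
      by (simp only: diff_conv_add_uminus)
    have "(1 - z) powi (int (card (edges G)) - int (card (verts G))) =
        (1 - z) ^ card (edges G) / (1 - z) ^ card (verts G)"
      using that by (simp add: power_int_diff)
    then have "omega G z = (1 - z) ^ card (verts G) * theta G z (2 * \<i>) / (1 - z) ^ card (edges G)"
      by (simp add: omega_eq[OF G that])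
    also have "\<dots> = ?M z" using that by (simp only: num) simp
    finally show ?thesis .
  qed
  show ?thesis
  proof (cases "\<beta> = 1")
    case True
    have "continuous_on UNIV (omega G)"
      unfolding omega_def by (intro continuous_intros)
    then have "(omega G \<longlongrightarrow> omega G 1) (at 1)"
      by (simp add: continuous_on_def)
    moreover have "continuous_on UNIV ?M"
      unfolding matching_sum_def by (intro continuous_intros)
    then have "(?M \<longlongrightarrow> ?M 1) (at 1)"
      unfolding continuous_on_def by blast
    then have "(omega G \<longlongrightarrow> ?M 1) (at 1)"
      by (rule Lim_transform_eventually) (auto simp: eventually_at_filter away)
    ultimately show ?thesis using True LIM_unique by blast
  qed (rule away)
qed

section \<open>Zero-free regions of the matching sum\<close>

lemma Im_one_divide_nonpos:
  assumes "Im z > 0"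
  shows "Im (1 / z) \<le> 0"
proof -
  have "Im (1 / z) = - Im z / ((Re z)\<^sup>2 + (Im z)\<^sup>2)" by (simp add: Im_divide)
  then show ?thesis using assms by (simp add: divide_nonpos_nonneg)
qed

text \<open>Heilmann--Lieb argument. With the edge weight \<open>-u\<^sup>2\<close>, let \<open>R\<close> be the
  ratio of the sums for \<open>W\<close> and \<open>W - {v}\<close>, divided by \<open>u\<close>. It equals \<open>a\<^sub>v / u\<close> minus a nonnegative
  combination of the reciprocals of the corresponding quantities for \<open>W - {v}\<close>. As \<open>z \<mapsto> -1 / z\<close> preserves the
  upper half plane, these quantities stay there by induction; in particular no sum vanishes.\<close>

lemma matching_sum_nonzero_half_plane:
  fixes u :: complex
  assumes G: "finite_multigraph G" and u: "u \<noteq> 0" and W: "finite W"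
    and a: "\<And>i. i \<in> W \<Longrightarrow> Im (a i / u) > 0"
  shows "matching_sum G a (- u\<^sup>2) W \<noteq> 0"
proof -
  let ?M = "matching_sum G a (- u\<^sup>2)"
  have "?M W \<noteq> 0 \<and> (\<forall>v\<in>W. Im (?M W / (u * ?M (W - {v}))) > 0)"
    using W a
  proof (induction "card W" arbitrary: W rule: less_induct)
    case less
    have IH: "?M (W - {v}) \<noteq> 0"
      "w \<in> W - {v} \<Longrightarrow> Im (?M (W - {v}) / (u * ?M (W - {v} - {w}))) > 0" if v: "v \<in> W" for v w
    proof -
      have "card (W - {v}) < card W" using less.prems(1) v by (rule card_Diff1_less)
      from less.hyps[OF this] less.prems
      show "?M (W - {v}) \<noteq> 0"
        "w \<in> W - {v} \<Longrightarrow> Im (?M (W - {v}) / (u * ?M (W - {v} - {w}))) > 0" by auto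
    qed
    have pos: "Im (?M W / (u * ?M (W - {v}))) > 0" if v: "v \<in> W" for v
    proof -
      let ?R = "\<lambda>w. ?M (W - {v}) / (u * ?M (W - {v} - {w}))"
      define S where "S = (\<Sum>w\<in>W - {v}. of_nat (edge_mult G v w) * ?M (W - {v} - {w}))"
      have "(\<Sum>w\<in>W - {v}. of_nat (edge_mult G v w) * (1 / ?R w)) = u / ?M (W - {v}) * S"
        unfolding S_def sum_distrib_left by (intro sum.cong refl) simp
      moreover have "?M W = a v * ?M (W - {v}) - u\<^sup>2 * S"
        unfolding S_def matching_sum_remove[OF G less.prems(1) v] by simp
      ultimately have "?M W / (u * ?M (W - {v})) =
          a v / u - (\<Sum>w\<in>W - {v}. of_nat (edge_mult G v w) * (1 / ?R w))"
        using u IH(1)[OF v] by (simp add: diff_divide_distrib power2_eq_square)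
      moreover have "Im (1 / ?R w) \<le> 0" if "w \<in> W - {v}" for w
        by (rule Im_one_divide_nonpos[OF IH(2)[OF v that]])
      then have "Im (\<Sum>w\<in>W - {v}. of_nat (edge_mult G v w) * (1 / ?R w)) \<le> 0"
        unfolding Im_sum by (intro sum_nonpos) (simp add: mult_nonneg_nonpos del: times_divide_eq_right)
      ultimately show ?thesis using less.prems(2)[OF v] by simp
    qed
    show ?case
    proof (cases "W = {}")
      case True
      then show ?thesis by (simp add: matching_sum_empty[OF G])
    next
      case False
      then obtain v where "v \<in> W" by blast
      then have "?M W \<noteq> 0" using pos by fastforce
      then show ?thesis using pos by blast
    qed
  qed
  then show ?thesis by blast
qed

text \<open>Let \<open>r\<close> be the number of edges from \<open>v\<close> to the rest of \<open>W\<close>. If \<open>r < d\<^sub>v\<close>, then the ratio of the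
  sums for \<open>W\<close> and \<open>W - {v}\<close> exceeds \<open>c = max 1 b\<close>. Indeed each neighbour of \<open>v\<close> loses an edge when
  \<open>v\<close> is removed, so by induction the ratio is at least \<open>1 + (d\<^sub>v - 1) b - r b / c\<close>, with strict
  inequality if \<open>r > 0\<close>, and
  \<open>1 + (d\<^sub>v - 1) b - (d\<^sub>v - 1) b / c \<ge> c\<close> because \<open>d\<^sub>v \<ge> 2\<close>. If no edge is lost and
  \<open>r = d\<^sub>v\<close>, the same estimate still gives a positive ratio.\<close>

lemma matching_sum_pos:
  fixes b :: real
  assumes G: "finite_multigraph G" and b: "b > 0"
    and d: "\<And>i. i \<in> verts G \<Longrightarrow> vdegree G i \<ge> 2"
    and W: "W \<subseteq> verts G"
  shows "matching_sum G (\<lambda>i. 1 + (real (vdegree G i) - 1) * b) (- b) W > 0"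
proof -
  let ?a = "\<lambda>i. 1 + (real (vdegree G i) - 1) * b"
  let ?M = "matching_sum G ?a (- b)"
  let ?r = "\<lambda>W v. \<Sum>w\<in>W - {v}. edge_mult G v w"
  define c where "c = max 1 b"
  have fV: "finite (verts G)" using G by (simp add: finite_multigraph_def)
  have "?M W > 0 \<and> (\<forall>v\<in>W. ?r W v < vdegree G v \<longrightarrow> ?M W > c * ?M (W - {v}))"
    using W
  proof (induction "card W" arbitrary: W rule: less_induct)
    case less
    have fW: "finite W" using less.prems fV by (rule finite_subset)
    have key: "?M W > 0" "?r W v < vdegree G v \<Longrightarrow> ?M W > c * ?M (W - {v})" if v: "v \<in> W" for v
    proof -
      let ?U = "W - {v}" and ?k = "?r W v" and ?d = "vdegree G v"
      have U: "card ?U < card W" "?U \<subseteq> verts G" "finite ?U"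
        using card_Diff1_less[OF fW v] fW less.prems by auto
      have MU: "?M ?U > 0" using less.hyps[OF U(1,2)] by blast
      have d2: "?d \<ge> 2" using d v less.prems by blast
      have kd: "?k \<le> ?d" using sum_edge_mult_le_vdegree[OF G, of ?U v] U by simp
      \<comment> \<open>The edge from \<open>w\<close> to \<open>v\<close> makes the residual degree of \<open>w\<close> smaller than its degree.\<close>
      have step: "?M (?U - {w}) < ?M ?U / c" if w: "w \<in> ?U" "edge_mult G v w > 0" for w
      proof -
        have "?r ?U w < (\<Sum>x\<in>W - {w}. edge_mult G w x)"
        proof -
          have "W - {w} = insert v (?U - {w})" using v w by auto
          then show ?thesis using U(3) w by (simp add: edge_mult_commute[of G w v])
        qed
        also have "\<dots> \<le> vdegree G w"
          using sum_edge_mult_le_vdegree[OF G, of "W - {w}" w] fW by simp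
        finally have "?M ?U > c * ?M (?U - {w})" using less.hyps[OF U(1,2)] w by blast
        then show ?thesis by (simp add: c_def field_simps)
      qed
      have M: "?M W = ?a v * ?M ?U - b * (\<Sum>w\<in>?U. real (edge_mult G v w) * ?M (?U - {w}))"
        using matching_sum_remove[OF G fW v, of ?a "- b"] by simp
      define k where "k = real ?k"
      define m where "m = real ?d - 1"
      have km: "k \<ge> 0" "m \<ge> 1" "k \<le> m + 1" using kd d2 by (simp_all add: k_def m_def del: of_nat_sum)
      have c: "c \<ge> 1" "c = 1 \<and> b \<le> 1 \<or> c = b" using b by (auto simp: c_def)
      have gt: "?M W > (1 + m * b - b / c * k) * ?M ?U" if "k > 0"
      proof -
        have "?k \<noteq> 0" using that by (simp add: k_def del: of_nat_sum sum_eq_0_iff)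
        then obtain w where "w \<in> ?U" "edge_mult G v w \<noteq> 0"
          by (rule sum.not_neutral_contains_not_neutral)
        then have w: "w \<in> ?U" "edge_mult G v w > 0" by simp_all
        have "(\<Sum>w\<in>?U. real (edge_mult G v w) * ?M (?U - {w})) <
            (\<Sum>w\<in>?U. real (edge_mult G v w) * (?M ?U / c))"
        proof (rule sum_strict_mono_ex1[OF U(3)])
          show "\<forall>w\<in>?U. real (edge_mult G v w) * ?M (?U - {w}) \<le> real (edge_mult G v w) * (?M ?U / c)"
          proof
            fix w assume w: "w \<in> ?U"
            show "real (edge_mult G v w) * ?M (?U - {w}) \<le> real (edge_mult G v w) * (?M ?U / c)"
            proof (cases "edge_mult G v w = 0")
              case False
              then show ?thesis using step[OF w] by (intro mult_left_mono) simp_all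
            qed simp
          qed
          show "\<exists>w\<in>?U. real (edge_mult G v w) * ?M (?U - {w}) < real (edge_mult G v w) * (?M ?U / c)"
            by (rule bexI[OF _ w(1)], rule mult_strict_left_mono[OF step[OF w]]) (use w in simp)
        qed
        also have "\<dots> = k * (?M ?U / c)" unfolding k_def of_nat_sum sum_distrib_right ..
        finally have "b * (\<Sum>w\<in>?U. real (edge_mult G v w) * ?M (?U - {w})) < b * (k * (?M ?U / c))"
          using b by (rule mult_strict_left_mono)
        moreover have "(1 + m * b - b / c * k) * y = (1 + m * b) * y - b * (k * (y / c))" for y
          by (simp add: algebra_simps)
        ultimately show ?thesis by (simp only: M m_def)
      qed
      have zero: "?M W = (1 + m * b) * ?M ?U" if "k = 0"
      proof -
        have "edge_mult G v w = 0" if "w \<in> ?U" for w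
          using \<open>k = 0\<close> that U(3) by (simp add: k_def del: of_nat_sum)
        then show ?thesis by (simp add: M m_def)
      qed
      have mb: "m * b \<ge> b" using km b by simp
      show "?M W > 0"
      proof (cases "k = 0")
        case True
        then show ?thesis using zero MU b km by (simp add: add_pos_nonneg)
      next
        case False
        have "b / c * k \<le> b / c * (m + 1)"
          using b c km by (intro mult_left_mono) auto
        also have "\<dots> \<le> 1 + m * b"
          using c(2)
        proof
          assume "c = 1 \<and> b \<le> 1"
          then show ?thesis by (simp add: algebra_simps)
        next
          assume "c = b"
          moreover have "m * 1 \<le> m * b" using c \<open>c = b\<close> km by (intro mult_left_mono) auto
          ultimately show ?thesis using b by simp
        qed
        finally have "0 \<le> (1 + m * b - b / c * k) * ?M ?U" using MU by simp
        then show ?thesis using gt False km by linarith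
      qed
      show "?M W > c * ?M ?U" if "?k < ?d"
      proof (cases "k = 0")
        case True
        moreover have "c < 1 + m * b" using c(2) mb b km by (auto simp: add_strict_increasing)
        ultimately show ?thesis using zero MU by simp
      next
        case False
        have "k \<le> m" using that by (simp add: k_def m_def del: of_nat_sum)
        then have "b / c * k \<le> b / c * m"
          using b c by (intro mult_left_mono) auto
        also have "\<dots> \<le> 1 + m * b - c"
          using c(2)
        proof
          assume "c = 1 \<and> b \<le> 1"
          then show ?thesis by (simp add: algebra_simps)
        next
          assume "c = b"
          moreover have "(m - 1) * (b - 1) \<ge> 0" using c \<open>c = b\<close> km by simp
          ultimately show ?thesis using b by (simp add: algebra_simps)
        qed
        finally have "c * ?M ?U \<le> (1 + m * b - b / c * k) * ?M ?U"
          using MU by (intro mult_right_mono) auto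
        then show ?thesis using gt False km by linarith
      qed
    qed
    show ?case
    proof (cases "W = {}")
      case True
      then show ?thesis by (simp add: matching_sum_empty[OF G])
    next
      case False
      then show ?thesis using key by blast
    qed
  qed
  then show ?thesis by blast
qed

section \<open>Pruning\<close>

text \<open>A subgraph that contains the edge at \<open>v\<close> has degree one there, so its term has the factor
  \<open>f\<^sub>1 = 0\<close>; for the others the factor at \<open>v\<close> is \<open>f\<^sub>0 = 1\<close>.\<close>

lemma theta_delete_vertex:
  assumes G: "finite_multigraph G" and v: "v \<in> verts G" "vdegree G v = 1"
  shows "theta (delete_vertex G v) \<beta> \<gamma> = theta G \<beta> \<gamma>"
    and "card (edges G) = Suc (card (edges (delete_vertex G v)))"
proof -
  let ?H = "delete_vertex G v"
  have fin: "finite (edges G)" "finite (verts G)" using G by (auto simp: finite_multigraph_def)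
  have "(\<Sum>e\<in>edges G. count (ends G e) v) = 1" using v by (simp add: vdegree_def degree_in_def)
  then obtain e where e: "e \<in> edges G" "count (ends G e) v = 1"
    and other: "\<forall>e'\<in>edges G. e \<noteq> e' \<longrightarrow> count (ends G e') v = 0"
    unfolding sum_eq_1_iff[OF fin(1)] by blast
  have "v \<in># ends G e" using e(2) by (intro count_inI) simp
  moreover have "v \<notin># ends G e'" if "e' \<in> edges G" "e' \<noteq> e" for e'
    using other that by (simp add: not_in_iff)
  ultimately have eH: "edges ?H = edges G - {e}"
    unfolding delete_vertex_def by auto
  show "card (edges G) = Suc (card (edges ?H))"
    unfolding eH by (rule card_Suc_Diff1[OF fin(1) e(1), symmetric])
  have deg: "degree_in ?H s i = degree_in G s i" for s i
    by (simp add: degree_in_def delete_vertex_def)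
  let ?p = "\<lambda>W s. \<Prod>i\<in>W. poly (f_poly (degree_in G s i)) \<gamma>"
  have split: "?p (verts G) s = poly (f_poly (degree_in G s v)) \<gamma> * ?p (verts ?H) s" for s
    using prod.remove[OF fin(2) v(1)] by (simp add: delete_vertex_def)
  have zero: "degree_in G s v = 0" if "s \<in> Pow (edges G - {e})" for s
    unfolding degree_in_def by (rule sum.neutral) (use other that in auto)
  have one: "degree_in G (insert e s) v = 1" if s: "s \<in> Pow (edges G - {e})" for s
  proof -
    have "finite s" "e \<notin> s" using s fin by (auto intro: finite_subset)
    then show ?thesis using degree_in_insert[of s e G v] e zero[OF s] by simp
  qed
  have "theta G \<beta> \<gamma> = (\<Sum>s\<in>Pow (edges G - {e}). \<beta> ^ card s * ?p (verts G) s)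
      + (\<Sum>s\<in>Pow (edges G - {e}). \<beta> ^ card (insert e s) * ?p (verts G) (insert e s))"
    unfolding theta_def by (rule sum_Pow_remove(2)[OF fin(1) e(1)])
  also have "(\<Sum>s\<in>Pow (edges G - {e}). \<beta> ^ card (insert e s) * ?p (verts G) (insert e s)) = 0"
    by (rule sum.neutral) (simp add: split one del: Pow_iff)
  also have "(\<Sum>s\<in>Pow (edges G - {e}). \<beta> ^ card s * ?p (verts G) s) = theta ?H \<beta> \<gamma>"
    unfolding theta_def eH by (intro sum.cong refl) (simp add: split zero deg del: Pow_iff)
  finally show "theta ?H \<beta> \<gamma> = theta G \<beta> \<gamma>" by simp
qed

text \<open>Pruning removes one vertex and one edge, which preserves the exponent \<open>|E| - |V|\<close> as well.\<close>

lemma omega_prune: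
  assumes "finite_multigraph G" "prune_step\<^sup>*\<^sup>* G H"
  shows "finite_multigraph H \<and> omega H = omega G"
  using assms(2)
proof induction
  case base
  then show ?case using assms(1) by simp
next
  case (step H K)
  then have H: "finite_multigraph H" "omega H = omega G" by auto
  obtain v where v: "v \<in> verts H" "vdegree H v = 1" "K = delete_vertex H v"
    using step by (auto simp: prune_step_def)
  have "card (verts H) = Suc (card (verts K))"
    using card_Suc_Diff1[OF _ v(1)] H by (simp add: v(3) delete_vertex_def finite_multigraph_def)
  then have "omega_poly K = omega_poly H"
    using theta_delete_vertex[OF H(1) v(1,2)] by (simp add: omega_poly_def v(3))
  then have "omega K = omega H" by (simp add: omega_def fun_eq_iff)
  then show ?case using H v finite_multigraph_delete_vertex by metis
qed

section \<open>The annulus\<close>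

lemma Im_vertex_weight:
  assumes "u \<noteq> 0"
  shows "Im ((1 + (of_nat d - 1) * u\<^sup>2) / u) = Im u * (real d - 1 - 1 / cmod (u\<^sup>2))"
proof -
  have "(1 + (of_nat d - 1) * u\<^sup>2) / u = 1 / u + of_real (real d - 1) * u"
    using assms by (simp add: field_simps power2_eq_square)
  moreover have "Im (1 / u) = - Im u / cmod (u\<^sup>2)"
    by (simp add: Im_divide norm_power cmod_power2)
  ultimately show ?thesis by (simp only:) (simp add: algebra_simps)
qed

text \<open>This is stated for a graph whose degrees lie between \<open>m\<close> and \<open>M\<close>. The two sides of the annulus
  differ only in the choice of the square root of \<open>\<beta>\<close>: the one in the upper half plane puts all
  vertex weights there when \<open>|\<beta>|\<close> is too large, and its negative does so when \<open>|\<beta>|\<close> is too small.\<close>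

theorem omega_zero_bounds:
  assumes G: "finite_multigraph G" and m: "m \<ge> 2"
    and d: "\<And>i. i \<in> verts G \<Longrightarrow> m \<le> vdegree G i \<and> vdegree G i \<le> M"
    and zero: "omega G \<beta> = 0"
  shows "1 / (real M - 1) \<le> cmod \<beta> \<and> cmod \<beta> \<le> 1 / (real m - 1)"
proof -
  let ?a = "\<lambda>i. 1 + (of_nat (vdegree G i) - 1) * \<beta>"
  have fV: "finite (verts G)" using G by (simp add: finite_multigraph_def)
  have zero': "matching_sum G ?a (- \<beta>) (verts G) = 0"
    using zero by (simp add: omega_eq_matching_sum[OF G])
  have "verts G \<noteq> {}" using zero' matching_sum_empty[OF G, of ?a "- \<beta>"] by auto
  then obtain i where "i \<in> verts G" by blast
  then have mM: "m \<le> M" using d[of i] by simp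
  have d2: "vdegree G i \<ge> 2" if "i \<in> verts G" for i using d[OF that] m by simp
  have not_pos: "\<beta> \<noteq> of_real b" if "b > 0" for b
  proof
    assume b: "\<beta> = of_real b"
    have "matching_sum G ?a (- \<beta>) (verts G) =
        of_real (matching_sum G (\<lambda>i. 1 + (real (vdegree G i) - 1) * b) (- b) (verts G))"
      by (simp add: of_real_matching_sum b)
    moreover have "matching_sum G (\<lambda>i. 1 + (real (vdegree G i) - 1) * b) (- b) (verts G) > 0"
      by (rule matching_sum_pos[OF G that d2 order_refl])
    ultimately show False using zero' by simp
  qed
  have "\<beta> \<noteq> 0"
  proof
    assume "\<beta> = 0"
    moreover have "matching_sum G (\<lambda>_. 1) (0::complex) W = 1" if "finite W" for W
      using that by induction (simp_all add: matching_sum_empty[OF G] matching_sum_insert[OF G])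
    ultimately show False using zero' fV by simp
  qed
  obtain w where w: "w\<^sup>2 = \<beta>" using power2_csqrt by blast
  have "Im w \<noteq> 0"
  proof
    assume "Im w = 0"
    then have "w = of_real (Re w)" by (simp add: complex_eq_iff)
    then have "\<beta> = of_real ((Re w)\<^sup>2)" using w by (metis of_real_power)
    moreover from this have "(Re w)\<^sup>2 > 0" using \<open>\<beta> \<noteq> 0\<close> by simp
    ultimately show False using not_pos by blast
  qed
  define u where "u = (if Im w > 0 then w else - w)"
  have u: "u\<^sup>2 = \<beta>" "Im u > 0" using w \<open>Im w \<noteq> 0\<close> by (simp_all add: u_def)
  have no_root: False
    if u: "u\<^sup>2 = \<beta>"
      and pos: "\<And>i. i \<in> verts G \<Longrightarrow> Im u * (real (vdegree G i) - 1 - 1 / cmod \<beta>) > 0" for u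
  proof -
    have nz: "u \<noteq> 0" using u \<open>\<beta> \<noteq> 0\<close> by auto
    have "Im (?a i / u) > 0" if "i \<in> verts G" for i
      using pos[OF that] unfolding Im_vertex_weight[OF nz, unfolded u] .
    then have "matching_sum G ?a (- u\<^sup>2) (verts G) \<noteq> 0"
      by (rule matching_sum_nonzero_half_plane[OF G nz fV])
    then show False using zero' unfolding u by contradiction
  qed
  show ?thesis
  proof
    show "cmod \<beta> \<le> 1 / (real m - 1)"
    proof (rule ccontr)
      assume "\<not> ?thesis"
      then have less: "1 / cmod \<beta> < real m - 1"
        using m \<open>\<beta> \<noteq> 0\<close> by (simp add: field_simps)
      show False
      proof (rule no_root[OF u(1)])
        fix i assume "i \<in> verts G"
        then have "real m \<le> real (vdegree G i)" using d by simp
        then have "real (vdegree G i) - 1 - 1 / cmod \<beta> > 0" using less by linarith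
        then show "Im u * (real (vdegree G i) - 1 - 1 / cmod \<beta>) > 0" using u(2) by simp
      qed
    qed
    show "1 / (real M - 1) \<le> cmod \<beta>"
    proof (rule ccontr)
      assume "\<not> ?thesis"
      then have less: "real M - 1 < 1 / cmod \<beta>"
        using m mM \<open>\<beta> \<noteq> 0\<close> by (simp add: field_simps)
      show False
      proof (rule no_root[of "- u"])
        show "(- u)\<^sup>2 = \<beta>" using u(1) by simp
        fix i assume "i \<in> verts G"
        then have "real (vdegree G i) \<le> real M" using d by simp
        then have "real (vdegree G i) - 1 - 1 / cmod \<beta> < 0" using less by linarith
        then show "Im (- u) * (real (vdegree G i) - 1 - 1 / cmod \<beta>) > 0"
          using u(2) by (simp add: mult_pos_neg)
      qed
    qed
  qed
qed

theorem corollary2: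
  fixes G H :: "('v, 'e) multigraph" and d_m d_M :: nat and \<beta> :: complex
  assumes "finite_multigraph G"
    and "is_core H G"
    and "d_m = Min (vdegree H ` verts H)"
    and "d_M = Max (vdegree H ` verts H)"
    and "d_m \<ge> 2"
    and "omega G \<beta> = 0"
  shows "1 / (real d_M - 1) \<le> cmod \<beta> \<and> cmod \<beta> \<le> 1 / (real d_m - 1)"
proof -
  have "prune_step\<^sup>*\<^sup>* G H" using assms(2) unfolding is_core_def by blast
  from omega_prune[OF assms(1) this]
  have H: "finite_multigraph H" "omega H \<beta> = 0" using assms(6) by simp_all
  then have fin: "finite (vdegree H ` verts H)" by (simp add: finite_multigraph_def)
  have "d_m \<le> vdegree H i \<and> vdegree H i \<le> d_M" if "i \<in> verts H" for i
    unfolding assms(3,4) using fin that by (intro conjI Min_le Max_ge imageI)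
  then show ?thesis by (rule omega_zero_bounds[OF H(1) assms(5) _ H(2)])
qed

end
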